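(* Let $K$ be any field and let $e_1,e_2,e_3$ be the standard basis of $K^3$. Then the tensor $$\det_3=\sum_{\sigma\in\Sigma_3}\operatorname{sgn}(\sigma)\, e_{\sigma(1)}\otimes e_{\sigma(2)}\otimes e_{\sigma(3)}\in K^3\otimes K^3\otimes K^3$$ has tensor rank exactly $5$.
   Context: $\Sigma_3$ is the symmetric group on three letters. A simple (rank $1$) tensor is one of the form $v_1\otimes v_2\otimes v_3$. The tensor rank $\operatorname{trk}(T)$ of $T$ is the smallest integer $r$ such that $T$ is a sum of $r$ simple tensors. *)

theory Defs
  imports "HOL-Analysis.Determinants"
begin

text \<open>
  There is no tensor product of vector spaces in the library. The space
  \<open>K\<^sup>l \<otimes> K\<^sup>m \<otimes> K\<^sup>n\<close> is modelled by the arrays \<open>T $ i $ j $ k\<close> of coordinates with respect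
  to the standard basis \<open>e\<^sub>i \<otimes> e\<^sub>j \<otimes> e\<^sub>k\<close>; the lemmas below record that the product is
  trilinear and that every array is the corresponding combination of these basis tensors.
  In the type, the first tensor factor is the outermost (last written) index.
\<close>

definition tensor3 ::
    "'a::field ^ 'l \<Rightarrow> 'a ^ 'm \<Rightarrow> 'a ^ 'n \<Rightarrow> 'a ^ 'n ^ 'm ^ 'l"
  where "tensor3 u v w = (\<chi> i j k. u $ i * v $ j * w $ k)"

definition tensor_scale :: "'a::field \<Rightarrow> 'a ^ 'n ^ 'm ^ 'l \<Rightarrow> 'a ^ 'n ^ 'm ^ 'l"
  where "tensor_scale c T = (\<chi> i j k. c * T $ i $ j $ k)"

lemma tensor3_add:
  "tensor3 (u + u') v w = tensor3 u v w + tensor3 u' v w"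
  "tensor3 u (v + v') w = tensor3 u v w + tensor3 u v' w"
  "tensor3 u v (w + w') = tensor3 u v w + tensor3 u v w'"
  by (simp_all add: tensor3_def vec_eq_iff algebra_simps)

lemma tensor3_scale:
  "tensor3 (c *s u) v w = tensor_scale c (tensor3 u v w)"
  "tensor3 u (c *s v) w = tensor_scale c (tensor3 u v w)"
  "tensor3 u v (c *s w) = tensor_scale c (tensor3 u v w)"
  by (simp_all add: tensor3_def tensor_scale_def vec_eq_iff algebra_simps)

lemma tensor3_basis_expansion:
  fixes T :: "'a::field ^ 'n ^ 'm ^ 'l"
  shows "T = (\<Sum>i\<in>UNIV. \<Sum>j\<in>UNIV. \<Sum>k\<in>UNIV.
    tensor_scale (T $ i $ j $ k) (tensor3 (axis i 1) (axis j 1) (axis k 1)))"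
  by (simp add: vec_eq_iff tensor3_def tensor_scale_def axis_def
      if_distrib[where f = "\<lambda>x. _ * x"] if_distrib[where f = "\<lambda>x. x * _"] cong: if_cong)

definition simple_tensor :: "'a::field ^ 'n ^ 'm ^ 'l \<Rightarrow> bool"
  where "simple_tensor T \<longleftrightarrow> (\<exists>u v w. T = tensor3 u v w)"

text \<open>The zero tensor counts as simple; this does not affect the minimum, since zero summands
  can be dropped.\<close>

definition tensor_rank :: "'a::field ^ 'n ^ 'm ^ 'l \<Rightarrow> nat"
  where "tensor_rank T =
    (LEAST r. \<exists>S :: nat \<Rightarrow> 'a ^ 'n ^ 'm ^ 'l. (\<forall>i<r. simple_tensor (S i)) \<and> T = (\<Sum>i<r. S i))"

text \<open>The three elements of the index type \<open>3\<close> are \<open>1\<close>, \<open>2\<close> and \<open>3\<close> (with \<open>3 = 0\<close>).\<close>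

definition det3 :: "'a::field ^ 3 ^ 3 ^ 3"
  where "det3 = (\<Sum>\<sigma> | \<sigma> permutes (UNIV :: 3 set).
    tensor_scale (of_int (sign \<sigma>))
      (tensor3 (axis (\<sigma> 1) 1) (axis (\<sigma> 2) 1) (axis (\<sigma> 3) 1)))"

end

theory Submission
  imports Defs
begin

text \<open>
  Contracting \<open>det\<^sub>3\<close> with \<open>x\<close>, \<open>y\<close>, \<open>z\<close> gives \<open>D(x,y,z) = det[x,y,z]\<close>. Suppose that
  \<open>D(x,y,z) = \<Sum>\<^sub>i (x\<bullet>u\<^sub>i)(y\<bullet>v\<^sub>i)(z\<bullet>w\<^sub>i)\<close> with four summands. No nonzero \<open>x\<close> is orthogonal to
  three of the \<open>u\<^sub>i\<close>, since \<open>D(x,\<cdot>,\<cdot>)\<close> would have rank at most one; likewise for \<open>v\<close> and \<open>w\<close>.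
  Take \<open>y \<noteq> 0\<close> orthogonal to \<open>v\<^sub>0, v\<^sub>1\<close>. Testing \<open>D(x,y,y) = 0\<close> on suitable \<open>x\<close> shows that \<open>y\<close>
  is orthogonal to \<open>w\<^sub>2, w\<^sub>3\<close>, hence neither to \<open>w\<^sub>0\<close> nor to \<open>w\<^sub>1\<close>. Now \<open>D(x,y,z) + D(x,z,y) = 0\<close>
  with \<open>x\<close> orthogonal to \<open>u\<^sub>2, u\<^sub>3\<close> becomes a relation between \<open>v\<^sub>0\<close> and \<open>v\<^sub>1\<close> with nonzero
  coefficients, which fails on a \<open>z\<close> orthogonal to \<open>v\<^sub>0, v\<^sub>2\<close>. Division by \<open>2\<close> never occurs, so
  the characteristic is irrelevant.
\<close>

definition dot :: "'a::field ^ 'n \<Rightarrow> 'a ^ 'n \<Rightarrow> 'a"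
  where "dot x y = (\<Sum>i\<in>UNIV. x $ i * y $ i)"

definition contract3 :: "'a::field ^ 'n ^ 'm ^ 'l \<Rightarrow> 'a ^ 'l \<Rightarrow> 'a ^ 'm \<Rightarrow> 'a ^ 'n \<Rightarrow> 'a"
  where "contract3 T x y z = (\<Sum>i\<in>UNIV. \<Sum>j\<in>UNIV. \<Sum>k\<in>UNIV. T $ i $ j $ k * x $ i * y $ j * z $ k)"

lemma dot_axis: "dot x (axis i 1) = x $ i"
  by (simp add: dot_def axis_def if_distrib[where f = "\<lambda>x. _ * x"] cong: if_cong)

lemma contract3_tensor3: "contract3 (tensor3 u v w) x y z = dot x u * dot y v * dot z w"
proof -
  have "dot x u * dot y v * dot z w = (\<Sum>i\<in>UNIV. x $ i * u $ i * (dot y v * dot z w))"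
    by (simp only: dot_def[of x u] sum_distrib_right mult.assoc)
  also have "\<dots> = (\<Sum>i\<in>UNIV. \<Sum>j\<in>UNIV. x $ i * u $ i * (y $ j * v $ j * dot z w))"
    by (simp only: dot_def[of y v] sum_distrib_right sum_distrib_left)
  also have "\<dots> = contract3 (tensor3 u v w) x y z"
    by (simp add: contract3_def tensor3_def dot_def[of z w] sum_distrib_left mult_ac)
  finally show ?thesis by simp
qed

lemma contract3_scale: "contract3 (tensor_scale c T) x y z = c * contract3 T x y z"
  by (simp add: contract3_def tensor_scale_def sum_distrib_left mult.assoc)

lemma contract3_sum: "contract3 (sum S A) x y z = (\<Sum>a\<in>A. contract3 (S a) x y z)"
proof (induction A rule: infinite_finite_induct)
  case (insert a A)
  then show ?case by (simp add: contract3_def distrib_right sum.distrib)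
qed (simp_all add: contract3_def)

lemma contract3_axis: "contract3 T (axis i 1) (axis j 1) (axis k 1) = T $ i $ j $ k"
  by (simp add: contract3_def axis_def if_distrib[where f = "\<lambda>x. _ * x"]
      if_distrib[where f = "\<lambda>x. x * _"] cong: if_cong)

lemma contract3_det3:
  "contract3 det3 x y z = det (vector [x, y, z] :: 'a::field ^ 3 ^ 3)"
proof -
  have "(\<Prod>i\<in>UNIV. (vector [x, y, z] :: 'a ^ 3 ^ 3) $ i $ p i) = x $ p 1 * y $ p 2 * z $ p 3" for p
    unfolding UNIV_3 by (simp add: mult.assoc)
  then show ?thesis
    by (simp add: det3_def det_def contract3_sum contract3_scale contract3_tensor3 dot_axis)
qed

text \<open>Reduces each entry to a determinant of basis vectors, so that identities for
  \<open>det3\<close> can be checked entry by entry without enumerating permutations.\<close>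

lemma det3_nth: "det3 $ i $ j $ k = det (vector [axis i 1, axis j 1, axis k 1] :: 'a::field ^ 3 ^ 3)"
  by (simp flip: contract3_axis contract3_det3)

lemma det_vector3_cycle:
  "det (vector [x, y, z] :: 'a::field ^ 3 ^ 3) = det (vector [y, z, x] :: 'a ^ 3 ^ 3)"
  by (simp add: det_3 algebra_simps)

lemma exists_nonzero_orthogonal:
  fixes p q :: "'a::field ^ 3"
  obtains x where "x \<noteq> 0" "dot x p = 0" "dot x q = 0"
proof -
  \<comment> \<open>The zero row pads two equations to a singular square matrix.\<close>
  let ?A = "vector [p, q, 0] :: 'a ^ 3 ^ 3"
  have "det ?A = 0" by (simp add: det_3)
  then have "\<not> invertible ?A" by (simp add: invertible_det_nz)
  then obtain x where x: "x \<noteq> 0" "?A *v x = 0"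
    by (metis invertible_left_inverse matrix_left_invertible_ker)
  then have "dot x p = 0" "dot x q = 0"
    by (auto simp: vec_eq_iff forall_3 matrix_vector_mult_def dot_def mult_ac)
  with x(1) that show thesis by blast
qed

text \<open>The matrix of D(x,\<cdot>,\<cdot>) is skew with zero diagonal. Its principal 2x2 minors
  are the squares of the coordinates of x, and rank at most one makes them vanish.\<close>

lemma det_slice_rank_one:
  fixes x v w :: "'a::field ^ 3"
  assumes "\<And>y z. det (vector [x, y, z] :: 'a ^ 3 ^ 3) = c * dot y v * dot z w"
  shows "x = 0"
proof -
  have e: "det (vector [x, axis i 1, axis j 1] :: 'a ^ 3 ^ 3) = c * v $ i * w $ j" for i j
    using assms[of "axis i 1" "axis j 1"]
    by (simp add: dot_def axis_def if_distrib[where f = "\<lambda>x. x * _"] cong: if_cong)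
  have "x $ 1 * x $ 1 = 0"
    using e[of 2 3] e[of 3 2] e[of 2 2] e[of 3 3] by (simp add: det_3 axis_def) algebra
  moreover have "x $ 2 * x $ 2 = 0"
    using e[of 1 3] e[of 3 1] e[of 1 1] e[of 3 3] by (simp add: det_3 axis_def) algebra
  moreover have "x $ 3 * x $ 3 = 0"
    using e[of 1 2] e[of 2 1] e[of 1 1] e[of 2 2] by (simp add: det_3 axis_def) algebra
  ultimately show ?thesis by (simp add: vec_eq_iff forall_3)
qed

lemma det_decomposition4_kernel:
  fixes u v w :: "nat \<Rightarrow> 'a::field ^ 3"
  assumes D: "\<And>x y z. det (vector [x, y, z] :: 'a ^ 3 ^ 3) =
      (\<Sum>i<4. dot x (u i) * dot y (v i) * dot z (w i))"
    and i: "i < 4" and ort: "\<And>j. j < 4 \<Longrightarrow> j \<noteq> i \<Longrightarrow> dot x (u j) = 0"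
  shows "x = 0"
proof (rule det_slice_rank_one)
  fix y z
  have "det (vector [x, y, z] :: 'a ^ 3 ^ 3) =
      (\<Sum>j<4. if j = i then dot x (u i) * dot y (v i) * dot z (w i) else 0)"
    unfolding D by (intro sum.cong) (auto simp: ort)
  also have "\<dots> = dot x (u i) * dot y (v i) * dot z (w i)"
    using i by simp
  finally show "det (vector [x, y, z] :: 'a ^ 3 ^ 3) = dot x (u i) * dot y (v i) * dot z (w i)" .
qed

lemma not_det_decomposition4:
  fixes u v w :: "nat \<Rightarrow> 'a::field ^ 3"
  assumes D: "\<And>x y z. det (vector [x, y, z] :: 'a ^ 3 ^ 3) =
      (\<Sum>i<4. dot x (u i) * dot y (v i) * dot z (w i))"
  shows False
proof -
  \<comment> \<open>Cyclic invariance of det moves \<open>v\<close> or \<open>w\<close> into the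
    first slot, where the kernel lemma applies.\<close>
  have Dv: "det (vector [x, y, z] :: 'a ^ 3 ^ 3) = (\<Sum>i<4. dot x (v i) * dot y (w i) * dot z (u i))"
    for x y z
    by (subst det_vector3_cycle, subst det_vector3_cycle, subst D) (simp add: mult_ac)
  have Dw: "det (vector [x, y, z] :: 'a ^ 3 ^ 3) = (\<Sum>i<4. dot x (w i) * dot y (u i) * dot z (v i))"
    for x y z
    by (subst det_vector3_cycle, subst D) (simp add: mult_ac)
  have four: "j = 0 \<or> j = 1 \<or> j = 2 \<or> j = 3" if "j < 4" for j :: nat
    using that by auto
  have ku: "x = 0" if "i < 4" "\<And>j. j < 4 \<Longrightarrow> j \<noteq> i \<Longrightarrow> dot x (u j) = 0" for i x
    using det_decomposition4_kernel[OF D that] .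
  have kv: "x = 0" if "i < 4" "\<And>j. j < 4 \<Longrightarrow> j \<noteq> i \<Longrightarrow> dot x (v j) = 0" for i x
    using det_decomposition4_kernel[OF Dv that] .
  have kw: "x = 0" if "i < 4" "\<And>j. j < 4 \<Longrightarrow> j \<noteq> i \<Longrightarrow> dot x (w j) = 0" for i x
    using det_decomposition4_kernel[OF Dw that] .
  have D4: "det (vector [x, y, z] :: 'a ^ 3 ^ 3) =
      dot x (u 0) * dot y (v 0) * dot z (w 0) + dot x (u 1) * dot y (v 1) * dot z (w 1) +
      dot x (u 2) * dot y (v 2) * dot z (w 2) + dot x (u 3) * dot y (v 3) * dot z (w 3)" for x y z
    unfolding D by (simp add: eval_nat_numeral)

  obtain y where y: "y \<noteq> 0" "dot y (v 0) = 0" "dot y (v 1) = 0"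
    using exists_nonzero_orthogonal by blast
  have yv2: "dot y (v 2) \<noteq> 0" using kv[of 3 y] y four by auto
  have yv3: "dot y (v 3) \<noteq> 0" using kv[of 2 y] y four by auto
  have alt: "det (vector [x, y, y] :: 'a ^ 3 ^ 3) = 0" for x
    by (simp add: det_3 algebra_simps)
  have quad: "dot x (u 2) * dot y (v 2) * dot y (w 2) + dot x (u 3) * dot y (v 3) * dot y (w 3) = 0"
    for x
    using alt[of x] y by (simp add: D4)
  have yw2: "dot y (w 2) = 0"
  proof -
    \<comment> \<open>Orthogonality to \<open>u 3\<close> isolates one term of \<open>quad\<close>;
      orthogonality to \<open>u 0\<close> ensures, by \<open>ku\<close>, that its factor at
      \<open>u 2\<close> is nonzero.\<close>
    obtain x where x: "x \<noteq> 0" "dot x (u 0) = 0" "dot x (u 3) = 0"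
      using exists_nonzero_orthogonal by blast
    then have "dot x (u 2) \<noteq> 0" using ku[of 1 x] four by auto
    with quad[of x] x yv2 show ?thesis by simp
  qed
  have yw3: "dot y (w 3) = 0"
  proof -
    obtain x where x: "x \<noteq> 0" "dot x (u 0) = 0" "dot x (u 2) = 0"
      using exists_nonzero_orthogonal by blast
    then have "dot x (u 3) \<noteq> 0" using ku[of 1 x] four by auto
    with quad[of x] x yv3 show ?thesis by simp
  qed
  have yw1: "dot y (w 1) \<noteq> 0" using kw[of 0 y] y yw2 yw3 four by auto

  obtain x where x: "x \<noteq> 0" "dot x (u 2) = 0" "dot x (u 3) = 0"
    using exists_nonzero_orthogonal by blast
  have xu1: "dot x (u 1) \<noteq> 0" using ku[of 0 x] x four by auto
  obtain z where z: "z \<noteq> 0" "dot z (v 0) = 0" "dot z (v 2) = 0"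
    using exists_nonzero_orthogonal by blast
  have zv1: "dot z (v 1) \<noteq> 0" using kv[of 3 z] z four by auto
  have "det (vector [x, y, z] :: 'a ^ 3 ^ 3) + det (vector [x, z, y] :: 'a ^ 3 ^ 3) = 0"
    by (simp add: det_3 algebra_simps)
  \<comment> \<open>D(x,y,z) vanishes termwise, and D(x,z,y) keeps only its term of index 1.\<close>
  then have "dot x (u 1) * dot z (v 1) * dot y (w 1) = 0"
    using x y z by (simp add: D4)
  with xu1 zv1 yw1 show False by simp
qed

lemma simple_tensor_zero: "simple_tensor 0"
  unfolding simple_tensor_def by (rule exI[of _ 0]) (simp add: tensor3_def vec_eq_iff)

lemma det3_sum_simple_ge_5:
  fixes S :: "nat \<Rightarrow> 'a::field ^ 3 ^ 3 ^ 3"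
  assumes simple: "\<And>i. i < r \<Longrightarrow> simple_tensor (S i)" and eq: "det3 = (\<Sum>i<r. S i)"
  shows "5 \<le> r"
proof (rule ccontr)
  assume "\<not> 5 \<le> r"
  then have r: "r \<le> 4" by simp
  \<comment> \<open>Zero padding reduces every r \<le> 4 to exactly four summands.\<close>
  define S' where "S' i = (if i < r then S i else 0)" for i
  have "\<forall>i. \<exists>u v w. S' i = tensor3 u v w"
    using simple simple_tensor_zero unfolding S'_def simple_tensor_def by auto
  then obtain u v w where uvw: "\<And>i. S' i = tensor3 (u i) (v i) (w i)"
    by metis
  have "det3 = (\<Sum>i<4. S' i)"
    unfolding eq using r by (intro sum.mono_neutral_cong_left) (auto simp: S'_def)
  then have "contract3 det3 x y z = contract3 (\<Sum>i<4. S' i) x y z" for x y z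
    by (rule arg_cong)
  then have "det (vector [x, y, z] :: 'a ^ 3 ^ 3) =
      (\<Sum>i<4. dot x (u i) * dot y (v i) * dot z (w i))" for x y z
    by (simp add: contract3_det3 contract3_sum uvw contract3_tensor3)
  then show False by (rule not_det_decomposition4)
qed

text \<open>The upper bound: an explicit decomposition whose vectors have all coordinates in {-1, 0,
  1}, hence valid in every characteristic.\<close>

lemma det3_eq_sum5:
  fixes e :: "3 \<Rightarrow> 'a::field ^ 3"
  defines "e \<equiv> \<lambda>i. axis i 1"
  shows "det3 = tensor3 (e 2 + e 3) (e 1) (e 2) + tensor3 (- e 1 - e 3) (e 2) (e 1)
    + tensor3 (- e 2) (e 1 + e 3) (e 2 + e 3) + tensor3 (e 1) (e 2 + e 3) (e 1 + e 3)
    + tensor3 (e 2 - e 1) (e 3) (e 1 + e 2 + e 3)"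
  unfolding vec_eq_iff det3_nth
  by (simp add: forall_3 det_3 tensor3_def e_def axis_def)

theorem theorem1p3: "tensor_rank (det3 :: 'a::field ^ 3 ^ 3 ^ 3) = 5"
  unfolding tensor_rank_def
proof (rule Least_equality)
  let ?e = "\<lambda>i. axis i 1 :: 'a ^ 3"
  let ?L = "[tensor3 (?e 2 + ?e 3) (?e 1) (?e 2), tensor3 (- ?e 1 - ?e 3) (?e 2) (?e 1),
    tensor3 (- ?e 2) (?e 1 + ?e 3) (?e 2 + ?e 3), tensor3 (?e 1) (?e 2 + ?e 3) (?e 1 + ?e 3),
    tensor3 (?e 2 - ?e 1) (?e 3) (?e 1 + ?e 2 + ?e 3)]"
  have "\<forall>i<5. simple_tensor (?L ! i)"
    unfolding simple_tensor_def by (auto simp: less_Suc_eq numeral_eq_Suc)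
  moreover have "det3 = (\<Sum>i<5. ?L ! i)"
    by (simp add: det3_eq_sum5 eval_nat_numeral)
  ultimately show "\<exists>S :: nat \<Rightarrow> 'a ^ 3 ^ 3 ^ 3. (\<forall>i<5. simple_tensor (S i)) \<and> det3 = (\<Sum>i<5. S i)"
    by blast
qed (use det3_sum_simple_ge_5 in blast)

end
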